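(* Let $G$ be a connected block graph, and let $k$ be the number of blocks of $G$ containing less than $3$ cut vertices of $G$. Then $\mathrm{src}(G) = k$.
   Context: All graphs are finite, simple, undirected and connected. A cut vertex is a vertex whose removal disconnects the graph. A biconnected graph is a connected graph having no cut vertices. A block of $G$ is a maximal biconnected component of $G$ (a single bridge edge $K_2$ counts as a block). A block graph is a graph in which every block is a clique; every edge lies in a unique block, and distinct blocks intersect in at most one vertex, which is then a cut vertex of $G$. Given a (not necessarily proper) coloring of the edges of $G$, a path is rainbow if no two of its edges have the same color. An edge-colored graph is strongly rainbow-connected if between every pair of vertices there is a shortest path that is rainbow. The strong rainbow connection number $\mathrm{src}(G)$ is the minimum number of colors needed in an edge-coloring making $G$ strongly rainbow-connected. *)

theory Defs
  imports Graph_Theory.Graph_Theory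
begin

text \<open>
  Finite simple undirected graphs are digraphs satisfying the locale predicate \<^const>\<open>graph\<close>:
  every edge \<open>{u, v}\<close> is represented by the two arcs \<open>(u, v)\<close> and \<open>(v, u)\<close>. Each edge is
  a single object to be coloured, so colourings are functions on the two-element vertex sets below.
\<close>

definition edges :: "('a, 'b) pre_digraph \<Rightarrow> 'a set set" where
  "edges G = {{u, v} | u v. u \<rightarrow>\<^bsub>G\<^esub> v}"

text \<open>
  \<^const>\<open>connected\<close> is false for the graph without vertices. Removing the only vertex of a
  one-vertex graph does not disconnect it, hence the second conjunct.
\<close>

definition cut_vertex :: "('a, 'b) pre_digraph \<Rightarrow> 'a \<Rightarrow> bool" where
  "cut_vertex G v \<longleftrightarrow>
     v \<in> verts G \<and> verts G \<noteq> {v} \<and> \<not> connected (pre_digraph.del_vert G v)"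

definition biconnected :: "('a, 'b) pre_digraph \<Rightarrow> bool" where
  "biconnected G \<longleftrightarrow> connected G \<and> (\<forall>v. \<not> cut_vertex G v)"

text \<open>
  A block has at least one edge. This only matters for the one-vertex graph, which thereby has no
  block: every vertex of a larger connected graph lies on an edge, whose endpoints
  induce a biconnected subgraph.
\<close>

definition block :: "('a, 'b) pre_digraph \<Rightarrow> ('a, 'b) pre_digraph \<Rightarrow> bool" where
  "block G B \<longleftrightarrow>
     pre_digraph.max_subgraph G (\<lambda>H. graph H \<and> edges H \<noteq> {} \<and> biconnected H) B"

definition block_graph :: "('a, 'b) pre_digraph \<Rightarrow> bool" where
  "block_graph G \<longleftrightarrow> (\<forall>B. block G B \<longrightarrow> complete_digraph (card (verts B)) B)"

definition path_between :: "('a, 'b) pre_digraph \<Rightarrow> 'a \<Rightarrow> 'a \<Rightarrow> 'a vwalk \<Rightarrow> bool" where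
  "path_between G u v p \<longleftrightarrow> vpath p G \<and> hd p = u \<and> last p = v"

definition shortest_path :: "('a, 'b) pre_digraph \<Rightarrow> 'a \<Rightarrow> 'a \<Rightarrow> 'a vwalk \<Rightarrow> bool" where
  "shortest_path G u v p \<longleftrightarrow>
     path_between G u v p \<and> (\<forall>q. path_between G u v q \<longrightarrow> vwalk_length p \<le> vwalk_length q)"

definition rainbow :: "('a set \<Rightarrow> 'c) \<Rightarrow> 'a vwalk \<Rightarrow> bool" where
  "rainbow c p \<longleftrightarrow> distinct (map (\<lambda>(u, v). c {u, v}) (vwalk_arcs p))"

definition strongly_rainbow_connected ::
    "('a, 'b) pre_digraph \<Rightarrow> ('a set \<Rightarrow> 'c) \<Rightarrow> bool" where
  "strongly_rainbow_connected G c \<longleftrightarrow>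
     (\<forall>u \<in> verts G. \<forall>v \<in> verts G. \<exists>p. shortest_path G u v p \<and> rainbow c p)"

definition src :: "('a, 'b) pre_digraph \<Rightarrow> nat" where
  "src G = (LEAST n. \<exists>c :: 'a set \<Rightarrow> nat.
     strongly_rainbow_connected G c \<and> card (c ` edges G) = n)"

end

theory Submission
  imports Defs
begin

text \<open>
  In a connected block graph the blocks are exactly the maximal cliques with at least two vertices.
  For a block \<open>K\<close>, every vertex \<open>v\<close> has a unique nearest vertex in \<open>K\<close>, its gate, and a geodesic
  between vertices with different gates runs through the edge joining the two gates; a vertex
  of \<open>K\<close> is a cut vertex iff it is the gate of some other vertex.

  Call a block low if it has fewer than three cut vertices. Lower bound: from each low block take
  an edge covering its cut vertices; any two of these edges lie on a common geodesic.
  Upper bound: use the low blocks as colours. An edge of a low block receives its own block. An edge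
  \<open>x y\<close> of any other block \<open>K\<close> receives a low block behind a third cut vertex of \<open>K\<close>, that is, one
  whose gate in \<open>K\<close> is neither \<open>x\<close> nor \<open>y\<close>. Comparing gates shows that two edges on a geodesic get
  different colours.
\<close>

section \<open>Connectivity of vertex sets under a bare adjacency relation\<close>

definition induced_reach :: "('a \<Rightarrow> 'a \<Rightarrow> bool) \<Rightarrow> 'a set \<Rightarrow> 'a \<Rightarrow> 'a \<Rightarrow> bool" where
  "induced_reach E S = (\<lambda>u v. E u v \<and> u \<in> S \<and> v \<in> S)\<^sup>*\<^sup>*"

definition connected_on :: "('a \<Rightarrow> 'a \<Rightarrow> bool) \<Rightarrow> 'a set \<Rightarrow> bool" where
  "connected_on E S \<longleftrightarrow> S \<noteq> {} \<and> (\<forall>u\<in>S. \<forall>v\<in>S. induced_reach E S u v)"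

text \<open>The guard \<open>S \<noteq> {v}\<close> is the convention of \<open>cut_vertex\<close>:
  \<open>connected_on\<close> fails for the empty set, so without the guard no singleton would be
  biconnected.\<close>

definition biconnected_on :: "('a \<Rightarrow> 'a \<Rightarrow> bool) \<Rightarrow> 'a set \<Rightarrow> bool" where
  "biconnected_on E S \<longleftrightarrow>
     connected_on E S \<and> (\<forall>v\<in>S. S \<noteq> {v} \<longrightarrow> connected_on E (S - {v}))"

definition clique_on :: "('a \<Rightarrow> 'a \<Rightarrow> bool) \<Rightarrow> 'a set \<Rightarrow> bool" where
  "clique_on E S \<longleftrightarrow> (\<forall>u\<in>S. \<forall>v\<in>S. u \<noteq> v \<longrightarrow> E u v)"

lemma induced_reach_refl [simp]: "induced_reach E S u u"
  by (simp add: induced_reach_def)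

lemma induced_reach_trans:
  "induced_reach E S u v \<Longrightarrow> induced_reach E S v w \<Longrightarrow> induced_reach E S u w"
  unfolding induced_reach_def by (rule rtranclp_trans)

lemma induced_reach_edge: "E u v \<Longrightarrow> u \<in> S \<Longrightarrow> v \<in> S \<Longrightarrow> induced_reach E S u v"
  unfolding induced_reach_def by (rule r_into_rtranclp) simp

lemma induced_reach_sym:
  assumes "symp E" "induced_reach E S u v"
  shows "induced_reach E S v u"
proof -
  have "symp (\<lambda>u v. E u v \<and> u \<in> S \<and> v \<in> S)"
    using assms(1) by (auto simp: symp_def)
  then show ?thesis
    using assms(2) unfolding induced_reach_def by (meson sympD symp_rtranclp)
qed

text \<open>Two points of \<open>S\<close> are joined through the points of the clique
  \<open>A\<close> that they reach. In the applications \<open>A\<close> is a maximal clique,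
  possibly with one vertex deleted.\<close>

lemma connected_onI:
  assumes "symp E" "A \<noteq> {}" "A \<subseteq> S"
    and A: "\<And>a b. a \<in> A \<Longrightarrow> b \<in> A \<Longrightarrow> a \<noteq> b \<Longrightarrow> E a b"
    and S: "\<And>s. s \<in> S \<Longrightarrow> \<exists>a\<in>A. induced_reach E S s a"
  shows "connected_on E S"
  unfolding connected_on_def
proof (intro conjI ballI)
  show "S \<noteq> {}" using assms by auto
  fix u v assume "u \<in> S" "v \<in> S"
  then obtain a b where ab: "a \<in> A" "induced_reach E S u a" "b \<in> A" "induced_reach E S v b"
    using S by meson
  have "induced_reach E S a b"
    using A[of a b] ab \<open>A \<subseteq> S\<close> by (cases "a = b") (auto intro: induced_reach_edge)
  then show "induced_reach E S u v"
    using ab induced_reach_sym[OF assms(1)] induced_reach_trans by metis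
qed

lemma successively_induced_reach_hd:
  assumes "successively E q" "t \<in> set q" "set q \<subseteq> S"
  shows "induced_reach E S (hd q) t"
  using assms
proof (induction q)
  case (Cons a q)
  show ?case
  proof (cases "t = a")
    case False
    then have "t \<in> set q" "q \<noteq> []" using Cons.prems by auto
    then have "induced_reach E S (hd q) t" "E a (hd q)"
      using Cons by (auto simp: successively_Cons)
    moreover have "induced_reach E S a (hd q)"
      using Cons.prems \<open>q \<noteq> []\<close> \<open>E a (hd q)\<close> hd_in_set[of q]
      by (intro induced_reach_edge) auto
    ultimately show ?thesis by (simp add: induced_reach_trans[of E S a "hd q" t])
  qed simp
qed simp

lemma successively_induced_reach_last:
  assumes "successively E q" "t \<in> set q" "set q \<subseteq> S"
  shows "induced_reach E S t (last q)"
  using assms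
proof (induction q)
  case (Cons a q)
  show ?case
  proof (cases "t \<in> set q")
    case True
    then show ?thesis using Cons by (auto simp: successively_Cons)
  next
    case False
    then have "t = a" using Cons.prems by auto
    then show ?thesis
      using Cons.prems successively_induced_reach_hd[of E "a # q" "last (a # q)" S]
      by simp
  qed
qed simp

section \<open>Walks as lists of vertices\<close>

lemma rtranclp_imp_distinct_successively:
  assumes "R\<^sup>*\<^sup>* u v"
  shows "\<exists>p. p \<noteq> [] \<and> hd p = u \<and> last p = v \<and> successively R p \<and> distinct p"
  using assms
proof (induction rule: converse_rtranclp_induct)
  case base
  show ?case by (rule exI[of _ "[v]"]) simp
next
  case (step u w)
  then obtain p where p: "p \<noteq> []" "hd p = w" "last p = v" "successively R p" "distinct p"
    by blast
  show ?case
  proof (cases "u \<in> set p")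
    case True
    \<comment> \<open>The new front vertex already lies on the path, so the loop back to it is cut
      off.\<close>
    then obtain p1 p2 where "p = p1 @ u # p2" by (meson split_list)
    then show ?thesis
      using p by (intro exI[of _ "u # p2"]) (auto simp: successively_append_iff)
  next
    case False
    then show ?thesis
      using p step by (intro exI[of _ "u # p"]) (auto simp: successively_Cons)
  qed
qed

lemma successively_relpowp:
  assumes "successively E p" "i \<le> j" "j < length p"
  shows "(E ^^ (j - i)) (p ! i) (p ! j)"
  using assms(2,3)
proof (induction j rule: dec_induct)
  case (step j)
  then show ?case
    using assms(1) by (auto simp: Suc_diff_le successively_conv_nth intro!: relcomppI)
qed simp

lemma relpowp_imp_successively:
  "(E ^^ n) u v \<Longrightarrow> \<exists>p. length p = Suc n \<and> hd p = u \<and> last p = v \<and> successively E p"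
proof (induction n arbitrary: u)
  case 0
  then show ?case by (intro exI[of _ "[u]"]) simp
next
  case (Suc n)
  then obtain w where "E u w" "(E ^^ n) w v" by (meson relpowp_Suc_E2)
  with Suc.IH obtain p where "length p = Suc n" "hd p = w" "last p = v" "successively E p"
    by blast
  with \<open>E u w\<close> show ?case
    by (intro exI[of _ "u # p"]) (auto simp: successively_Cons)
qed

text \<open>The block graph hypothesis appears without blocks: a biconnected set of vertices lies in
  a block, hence inside a clique. All of the combinatorics rests on this form.\<close>

locale connected_block_graph =
  fixes V :: "'a set" and E :: "'a \<Rightarrow> 'a \<Rightarrow> bool"
  assumes fin: "finite V"
    and E_V: "E u v \<Longrightarrow> u \<in> V \<and> v \<in> V"
    and E_symp: "symp E"
    and E_irrefl: "\<not> E u u"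
    and connected: "connected_on E V"
    and biconnected_clique: "S \<subseteq> V \<Longrightarrow> biconnected_on E S \<Longrightarrow> clique_on E S"
begin

lemma E_sym: "E u v \<Longrightarrow> E v u"
  using E_symp by (auto dest: sympD)

subsection \<open>Distances and geodesics\<close>

definition d :: "'a \<Rightarrow> 'a \<Rightarrow> nat" where
  "d u v = (LEAST n. (E ^^ n) u v)"

lemma rtranclp_E: "u \<in> V \<Longrightarrow> v \<in> V \<Longrightarrow> E\<^sup>*\<^sup>* u v"
  using connected mono_rtranclp[of "\<lambda>u v. E u v \<and> u \<in> V \<and> v \<in> V" E]
  unfolding connected_on_def induced_reach_def by blast

lemma d_le: "(E ^^ n) u v \<Longrightarrow> d u v \<le> n"
  unfolding d_def by (rule Least_le)

lemma relpowp_d: "u \<in> V \<Longrightarrow> v \<in> V \<Longrightarrow> (E ^^ d u v) u v"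
  unfolding d_def by (rule LeastI_ex) (simp add: rtranclp_E rtranclp_imp_relpowp)

lemma d_self [simp]: "d u u = 0"
  using d_le[of 0 u u] by simp

lemma d_eq_0: "u \<in> V \<Longrightarrow> v \<in> V \<Longrightarrow> d u v = 0 \<longleftrightarrow> u = v"
  using relpowp_d[of u v] by auto

lemma relpowp_trans: "(E ^^ m) u v \<Longrightarrow> (E ^^ n) v w \<Longrightarrow> (E ^^ (m + n)) u w"
  by (auto simp: relpowp_add)

lemma d_triangle: "u \<in> V \<Longrightarrow> v \<in> V \<Longrightarrow> w \<in> V \<Longrightarrow> d u w \<le> d u v + d v w"
  by (meson d_le relpowp_d relpowp_trans)

lemma relpowp_E_sym: "(E ^^ n) u v \<Longrightarrow> (E ^^ n) v u"
proof (induction n arbitrary: v)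
  case (Suc n)
  then obtain w where "(E ^^ n) u w" "E w v" by auto
  then show ?case using Suc.IH E_sym by (meson relpowp_Suc_I2)
qed auto

lemma d_sym: "u \<in> V \<Longrightarrow> v \<in> V \<Longrightarrow> d u v = d v u"
  by (meson d_le le_antisym relpowp_E_sym relpowp_d)

lemma d_E: "E u v \<Longrightarrow> d u v = 1"
  using d_le[of 1 u v] d_eq_0[of u v] E_V[of u v] E_irrefl[of u] by (cases "d u v") auto

lemma d_step:
  assumes "u \<in> V" "v \<in> V" "u \<noteq> v"
  obtains w where "E u w" "d u v = Suc (d w v)"
proof -
  obtain n where n: "d u v = Suc n"
    using assms d_eq_0 by (metis not0_implies_Suc)
  then obtain w where w: "E u w" "(E ^^ n) w v"
    using relpowp_d[of u v] assms by (metis relpowp_Suc_E2)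
  then have "d w v \<le> n" by (simp add: d_le)
  moreover have "d u v \<le> d u w + d w v"
    using d_triangle E_V w assms by blast
  ultimately show ?thesis using that[of w] w n d_E[OF w(1)] by simp
qed

text \<open>Distinctness follows from the minimal length, by \<open>geodesic_d_nth\<close>, and is
  therefore not part of the definition.\<close>

definition geodesic :: "'a \<Rightarrow> 'a \<Rightarrow> 'a list \<Rightarrow> bool" where
  "geodesic u v p \<longleftrightarrow>
     length p = Suc (d u v) \<and> hd p = u \<and> last p = v \<and> successively E p"

lemma geodesic_ex: "u \<in> V \<Longrightarrow> v \<in> V \<Longrightarrow> \<exists>p. geodesic u v p"
  unfolding geodesic_def using relpowp_imp_successively relpowp_d by metis

lemma geodesic_nth_V:
  assumes "geodesic u v p" "u \<in> V" "i < length p"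
  shows "p ! i \<in> V"
proof (cases i)
  case 0
  then show ?thesis using assms unfolding geodesic_def by (metis hd_conv_nth length_0_conv nat.distinct(1))
next
  case (Suc j)
  then show ?thesis using assms E_V unfolding geodesic_def successively_conv_nth by blast
qed

text \<open>The stretches before, between and after the two positions bound the three distances from
  above, and these bounds add up to \<open>d u v\<close>. By the triangle inequality none of them
  can be strict.\<close>

lemma geodesic_d_nth:
  assumes p: "geodesic u v p" and V: "u \<in> V" "v \<in> V" and ij: "i \<le> j" "j < length p"
  shows "d (p ! i) (p ! j) = j - i"
proof -
  have len: "length p = Suc (d u v)" and s: "successively E p" and "p \<noteq> []"
    using p by (auto simp: geodesic_def)
  have ends: "p ! 0 = u" "p ! d u v = v"
    using p \<open>p \<noteq> []\<close> len by (auto simp: geodesic_def hd_conv_nth last_conv_nth)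
  have le: "d (p ! a) (p ! b) \<le> b - a" if "a \<le> b" "b < length p" for a b
    using successively_relpowp[OF s that] by (rule d_le)
  have inV: "p ! i \<in> V" "p ! j \<in> V" using geodesic_nth_V p V ij by auto
  have "d u v \<le> d u (p ! i) + d (p ! i) v" "d (p ! i) v \<le> d (p ! i) (p ! j) + d (p ! j) v"
    using d_triangle V inV by blast+
  moreover have "d u (p ! i) \<le> i" "d (p ! j) v \<le> d u v - j"
    using le[of 0 i] le[of j "d u v"] ends ij len by auto
  ultimately show ?thesis using le[of i j] ij len by linarith
qed

subsection \<open>Maximal cliques and gates\<close>

text \<open>The stand-in for a block. The bound on the cardinality corresponds to the demand that a
  block has an edge.\<close>

definition max_clique :: "'a set \<Rightarrow> bool" where
  "max_clique K \<longleftrightarrow> K \<subseteq> V \<and> 2 \<le> card K \<and> clique_on E K \<and>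
     (\<forall>K'. K \<subseteq> K' \<longrightarrow> K' \<subseteq> V \<longrightarrow> clique_on E K' \<longrightarrow> K' = K)"

lemma max_clique_V: "max_clique K \<Longrightarrow> x \<in> K \<Longrightarrow> x \<in> V"
  unfolding max_clique_def by auto

lemma max_clique_E: "max_clique K \<Longrightarrow> x \<in> K \<Longrightarrow> y \<in> K \<Longrightarrow> x \<noteq> y \<Longrightarrow> E x y"
  unfolding max_clique_def clique_on_def by auto

lemma max_clique_other:
  assumes "max_clique K"
  obtains y where "y \<in> K" "y \<noteq> x"
proof -
  have "\<not> K \<subseteq> {x}"
  proof
    assume "K \<subseteq> {x}"
    then have "card K \<le> 1" using card_mono[of "{x}" K] by simp
    then show False using assms by (simp add: max_clique_def)
  qed
  then show ?thesis using that by auto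
qed

lemma max_clique_ex:
  assumes "clique_on E S" "S \<subseteq> V" "2 \<le> card S"
  obtains K where "max_clique K" "S \<subseteq> K"
proof -
  let ?P = "\<lambda>K. K \<subseteq> V \<and> clique_on E K"
  have "finite {K. ?P K}" using fin by (auto intro: finite_subset[of _ "Pow V"])
  then obtain K where K: "S \<subseteq> K" "?P K" "\<And>K'. ?P K' \<Longrightarrow> K \<subseteq> K' \<Longrightarrow> K = K'"
    using finite_has_maximal2[of "{K. ?P K}" S] assms by auto
  then have "2 \<le> card K"
    using assms(3) fin card_mono[of K S] finite_subset[of K V] by simp
  then have "max_clique K" using K unfolding max_clique_def by blast
  with K that show ?thesis by blast
qed

lemma edge_max_clique:
  assumes "E x y"
  obtains K where "max_clique K" "x \<in> K" "y \<in> K"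
proof -
  have "clique_on E {x, y}" using assms E_sym by (auto simp: clique_on_def)
  moreover have "card {x, y} = 2" using assms E_irrefl by (auto simp: card_insert_if)
  ultimately show ?thesis using max_clique_ex[of "{x, y}"] E_V[OF assms] that by auto
qed

text \<open>A path outside \<open>K\<close> joining two vertices of \<open>K\<close> would extend \<open>K\<close> to a larger biconnected set.\<close>

lemma no_ear:
  assumes K: "max_clique K" and xy: "x \<in> K" "y \<in> K" "x \<noteq> y"
    and u: "E x u" "u \<notin> K" and uv: "induced_reach E (V - K) u v" and v: "E v y"
  shows False
proof -
  let ?R = "\<lambda>u v. E u v \<and> u \<in> V - K \<and> v \<in> V - K"
  \<comment> \<open>The path is taken without repetitions, so that deleting one of its vertices
    leaves two pieces that avoid this vertex.\<close>
  obtain p where p: "p \<noteq> []" "hd p = u" "last p = v" "successively ?R p" "distinct p"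
    using rtranclp_imp_distinct_successively[of ?R u v] uv unfolding induced_reach_def by blast
  have sE: "successively E p" using p(4) by (rule successively_mono) auto
  have pV: "set p \<subseteq> V - K"
  proof
    fix t assume "t \<in> set p"
    then obtain i where i: "i < length p" "t = p ! i" by (auto simp: in_set_conv_nth)
    show "t \<in> V - K"
    proof (cases i)
      case 0
      then show ?thesis using i p u E_V by (auto simp: hd_conv_nth)
    next
      case (Suc j)
      then show ?thesis using i p(4) by (auto simp: successively_conv_nth)
    qed
  qed
  define S where "S = K \<union> set p"
  \<comment> \<open>\<open>X\<close> is empty or one deleted vertex, which treats both halves of
    biconnectivity at once.\<close>
  have conn: "connected_on E (S - X)" if X: "X = {} \<or> (\<exists>s\<in>S. X = {s})" for X
  proof (rule connected_onI[where A = "K - X"])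
    show "K - X \<noteq> {}" using X xy by auto
    show "\<exists>a\<in>K - X. induced_reach E (S - X) t a" if t: "t \<in> S - X" for t
    proof (cases "t \<in> K")
      case True
      then show ?thesis using t by (intro bexI[of _ t]) auto
    next
      case False
      then have tp: "t \<in> set p" using t by (auto simp: S_def)
      have via_x: "induced_reach E (S - X) t x"
        if q: "successively E q" "t \<in> set q" "set q \<subseteq> S - X" "hd q = u" "x \<notin> X" for q
      proof -
        have "u \<in> S - X" using q by (metis hd_in_set list.set_cases list.discI subsetD)
        then have "induced_reach E (S - X) u x"
          using u xy q E_sym by (intro induced_reach_edge) (auto simp: S_def)
        moreover have "induced_reach E (S - X) t u"
          using successively_induced_reach_hd[OF q(1-3)] induced_reach_sym[OF E_symp] q by simp
        ultimately show ?thesis using induced_reach_trans by metis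
      qed
      have via_y: "induced_reach E (S - X) t y"
        if q: "successively E q" "t \<in> set q" "set q \<subseteq> S - X" "last q = v" "y \<notin> X" for q
      proof -
        have "v \<in> S - X" using q by (metis last_in_set list.set_cases list.discI subsetD)
        then have "induced_reach E (S - X) v y"
          using v xy q by (intro induced_reach_edge) (auto simp: S_def)
        then show ?thesis
          using successively_induced_reach_last[OF q(1-3)] q induced_reach_trans by metis
      qed
      show ?thesis
      proof (cases "X \<inter> set p = {}")
        case True
        then have "set p \<subseteq> S - X" by (auto simp: S_def)
        \<comment> \<open>At most one end of the ear is deleted; the whole path leads to the other
          one.\<close>
        moreover have "x \<notin> X \<or> y \<notin> X" using X xy by auto
        ultimately show ?thesis using via_x[of p] via_y[of p] p sE tp xy by blast
      next
        case False
        then obtain s where s: "X = {s}" "s \<in> set p"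
          using X by auto
        then have "x \<notin> X" "y \<notin> X" using pV xy by auto
        \<comment> \<open>The deleted vertex lies on the path: the piece before it still hangs on
          \<open>x\<close>, the piece after it on \<open>y\<close>.\<close>
        obtain p1 p2 where pp: "p = p1 @ s # p2" using s by (meson split_list)
        then have s1: "successively E p1" "successively E p2"
          using sE by (auto simp: successively_append_iff successively_Cons)
        have sub: "set p1 \<subseteq> S - X" "set p2 \<subseteq> S - X"
          using pp p(5) s by (auto simp: S_def)
        consider "t \<in> set p1" | "t \<in> set p2" using tp pp t s by auto
        then show ?thesis
        proof cases
          case 1
          then have "hd p1 = u" using p pp by (cases p1) auto
          then show ?thesis using via_x[of p1] 1 s1 sub xy \<open>x \<notin> X\<close> by blast
        next
          case 2
          then have "last p2 = v" using p pp by auto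
          then show ?thesis using via_y[of p2] 2 s1 sub xy \<open>y \<notin> X\<close> by blast
        qed
      qed
    qed
  qed (use E_symp K in \<open>auto simp: S_def dest: max_clique_E\<close>)
  have "connected_on E S" using conn[of "{}"] by simp
  then have "biconnected_on E S" unfolding biconnected_on_def using conn by blast
  moreover have "S \<subseteq> V" using pV K by (auto simp: S_def max_clique_def)
  \<comment> \<open>Being biconnected, \<open>S\<close> is a clique, and \<open>K\<close> is
    maximal.\<close>
  ultimately have "S = K"
    using K biconnected_clique unfolding max_clique_def S_def by blast
  moreover have "u \<in> S" using p by (auto simp: S_def)
  ultimately show False using u by simp
qed

text \<open>A shortest path from \<open>v\<close> to a nearest vertex \<open>g\<close> of
  \<open>K\<close> meets \<open>K\<close> only at its end. The path without \<open>g\<close> is one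
  half of an ear for \<open>no_ear\<close>.\<close>

lemma nearest_reach:
  assumes K: "max_clique K" and "g \<in> K" "v \<in> V" "v \<notin> K" "\<forall>x\<in>K. d v g \<le> d v x"
  shows "\<exists>u. E g u \<and> u \<notin> K \<and> induced_reach E (V - K) u v"
  using assms(3-)
proof (induction "d v g" arbitrary: v)
  case 0
  then show ?case using d_eq_0 max_clique_V[OF K] assms(2) by metis
next
  case (Suc n)
  have gV: "g \<in> V" using max_clique_V[OF K] assms(2) by simp
  obtain w where w: "E v w" "d v g = Suc (d w g)"
    using d_step[of v g] Suc gV assms(2) by metis
  have wV: "w \<in> V" using w E_V by simp
  show ?case
  proof (cases "w \<in> K")
    case True
    then have "d v g \<le> 1" using Suc.prems d_E[OF w(1)] by metis
    then have "w = g" using w d_eq_0 wV gV by simp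
    then show ?thesis using w Suc.prems E_sym by (intro exI[of _ v]) auto
  next
    case False
    \<comment> \<open>The step to \<open>w\<close> lowers the distance to \<open>g\<close> by one
      and any other distance by at most one, so \<open>g\<close> remains nearest.\<close>
    have "d w g \<le> d w x" if "x \<in> K" for x
      using Suc.prems that w d_triangle[of v w x] d_E[OF w(1)] max_clique_V[OF K that] wV
      by fastforce
    then obtain u where u: "E g u" "u \<notin> K" "induced_reach E (V - K) u w"
      using Suc.hyps(1)[of w] Suc.hyps(2) w wV False by auto
    then have "induced_reach E (V - K) u v"
      using False Suc.prems w wV E_sym by (meson DiffI induced_reach_edge induced_reach_trans)
    with u show ?thesis by blast
  qed
qed

text \<open>Within a clique the distances from \<open>v\<close> differ by at most one. Two nearest
  vertices would both be reached from \<open>v\<close> outside \<open>K\<close>, and the two paths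
  would form an ear.\<close>

lemma gate_ex:
  assumes K: "max_clique K" and v: "v \<in> V"
  shows "\<exists>!g. g \<in> K \<and> (\<forall>x\<in>K. x \<noteq> g \<longrightarrow> d v x = Suc (d v g))"
proof (rule ex_ex1I)
  have "finite K" "K \<noteq> {}" using K fin by (auto simp: max_clique_def intro: finite_subset)
  then obtain g where g: "g \<in> K" "\<forall>x\<in>K. d v g \<le> d v x"
    using arg_min_if_finite[of K "d v"] by (meson linorder_not_less)
  have "d v x = Suc (d v g)" if x: "x \<in> K" "x \<noteq> g" for x
  proof (rule ccontr)
    assume *: "d v x \<noteq> Suc (d v g)"
    have V: "g \<in> V" "x \<in> V" using max_clique_V[OF K] g x by auto
    have "d v x \<le> Suc (d v g)"
      using d_triangle[of v g x] d_E[OF max_clique_E[OF K g(1) x(1)]] x V v by simp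
    then have eq: "d v x = d v g" using * g x by (simp add: le_antisym le_Suc_eq)
    have "v \<notin> K"
    proof
      assume "v \<in> K"
      then have "d v g = 0" using g by force
      then show False using eq d_eq_0 v V x by metis
    qed
    obtain u where u: "E g u" "u \<notin> K" "induced_reach E (V - K) u v"
      using nearest_reach[OF K g(1) v \<open>v \<notin> K\<close>] g by blast
    have "\<forall>y\<in>K. d v x \<le> d v y" using eq g by simp
    then obtain w where w: "E x w" "w \<notin> K" "induced_reach E (V - K) w v"
      using nearest_reach[OF K x(1) v \<open>v \<notin> K\<close>] by blast
    show False
      using no_ear[OF K g(1) x(1) _ u(1,2) induced_reach_trans[OF u(3) induced_reach_sym[OF E_symp w(3)]]] x w E_sym
      by metis
  qed
  then show "\<exists>g. g \<in> K \<and> (\<forall>x\<in>K. x \<noteq> g \<longrightarrow> d v x = Suc (d v g))" using g by blast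
qed (metis n_not_Suc_n Suc_n_not_le_n le_SucI order_refl)

definition gate :: "'a set \<Rightarrow> 'a \<Rightarrow> 'a" where
  "gate K v = (THE g. g \<in> K \<and> (\<forall>x\<in>K. x \<noteq> g \<longrightarrow> d v x = Suc (d v g)))"

lemma
  assumes "max_clique K" "v \<in> V"
  shows gate_in: "gate K v \<in> K"
    and d_gate: "x \<in> K \<Longrightarrow> x \<noteq> gate K v \<Longrightarrow> d v x = Suc (d v (gate K v))"
  using theI'[OF gate_ex[OF assms]] unfolding gate_def by blast+

text \<open>The distances from \<open>v\<close> to \<open>K\<close> take two values, the smaller one
  only at the gate, so a single pair of consecutive distances reveals the gate.\<close>

lemma gate_eqI:
  assumes "max_clique K" "v \<in> V" "x \<in> K" "y \<in> K" "d v y = Suc (d v x)"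
  shows "gate K v = x"
proof (rule ccontr)
  assume "gate K v \<noteq> x"
  then have "d v x = Suc (d v (gate K v))" using d_gate[OF assms(1,2,3)] by simp
  then show False using d_gate[OF assms(1,2,4)] assms(5) by (cases "y = gate K v") auto
qed

lemma gate_self:
  assumes "max_clique K" "x \<in> K"
  shows "gate K x = x"
proof -
  obtain y where y: "y \<in> K" "y \<noteq> x" using max_clique_other[OF assms(1)] .
  have "E x y" using max_clique_E assms y by simp
  then show ?thesis
    using gate_eqI[OF assms(1) _ assms(2) y(1)] d_E E_V by simp
qed

text \<open>The gate in \<open>K\<close> can change only along an edge of \<open>K\<close>: any
  other edge with different gates would close an ear between them.\<close>

lemma edge_gates_differ:
  assumes K: "max_clique K" and uv: "E u v" and ne: "gate K u \<noteq> gate K v"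
  shows "u \<in> K \<and> v \<in> K"
proof -
  let ?a = "gate K u" and ?b = "gate K v"
  have V: "u \<in> V" "v \<in> V" using E_V uv by auto
  note gK = gate_in[OF K V(1)] gate_in[OF K V(2)]
  have gV: "?a \<in> V" "?b \<in> V" using max_clique_V[OF K] gK by auto
  have dist: "d u ?b = Suc (d u ?a)" "d v ?a = Suc (d v ?b)"
    using d_gate[OF K] V gK ne by metis+
  have "d u ?b \<le> 1 + d v ?b" "d v ?a \<le> 1 + d u ?a"
    using d_triangle[of u v ?b] d_triangle[of v u ?a] V gV d_E[OF uv] d_E[OF E_sym[OF uv]] by auto
  \<comment> \<open>Distance zero to the gate means lying in \<open>K\<close>, so \<open>u\<close>
    and \<open>v\<close> are both inside or both outside.\<close>
  then have eq: "d u ?a = d v ?b" using dist by simp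
  have nK: "d w (gate K w) = 0 \<longleftrightarrow> w \<in> K" if "w \<in> V" for w
    using that gate_self[OF K] d_eq_0 gate_in[OF K that] max_clique_V[OF K] by fastforce
  show ?thesis
  proof (rule ccontr)
    assume "\<not> ?thesis"
    then have out: "u \<notin> K" "v \<notin> K" using nK V eq by metis+
    have near: "\<forall>x\<in>K. d w (gate K w) \<le> d w x" if "w \<in> V" for w
      using d_gate[OF K that] by (metis le_SucI order_refl)
    obtain u' where u': "E ?a u'" "u' \<notin> K" "induced_reach E (V - K) u' u"
      using nearest_reach[OF K gK(1) V(1) out(1) near[OF V(1)]] by blast
    obtain v' where v': "E ?b v'" "v' \<notin> K" "induced_reach E (V - K) v' v"
      using nearest_reach[OF K gK(2) V(2) out(2) near[OF V(2)]] by blast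
    have "induced_reach E (V - K) u' v'"
      using u' v' uv V out induced_reach_sym[OF E_symp] by (meson DiffI induced_reach_edge induced_reach_trans)
    then show False using no_ear[OF K gK ne u'(1,2) _ E_sym[OF v'(1)]] by blast
  qed
qed

text \<open>A vertex outside \<open>K\<close> has distance at least one to its gate and at least two
  to the rest of \<open>K\<close>, so it cannot be adjacent to both \<open>x\<close> and
  \<open>y\<close>.\<close>

lemma max_clique_eqI:
  assumes K: "max_clique K" and K': "max_clique K'"
    and xy: "x \<in> K" "y \<in> K" "x \<in> K'" "y \<in> K'" "x \<noteq> y"
  shows "K = K'"
proof -
  have "K' \<subseteq> K"
  proof
    fix v assume v: "v \<in> K'"
    show "v \<in> K"
    proof (rule ccontr)
      assume "v \<notin> K"
      then have "d v x = 1" "d v y = 1"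
        using v xy by (metis d_E max_clique_E[OF K'])+
      moreover have "d v (gate K v) \<noteq> 0"
        using \<open>v \<notin> K\<close> d_eq_0 gate_in[OF K] max_clique_V[OF K] max_clique_V[OF K' v] by metis
      ultimately show False
        using d_gate[OF K max_clique_V[OF K' v]] xy by (metis One_nat_def Suc_inject)
    qed
  qed
  then show ?thesis using K K' unfolding max_clique_def by blast
qed

text \<open>An edge of \<open>L\<close> with different gates would lie in \<open>K\<close>, giving
  \<open>L\<close> and \<open>K\<close> two common vertices. Hence \<open>K\<close> sees any other
  block through a single vertex.\<close>

lemma gate_const:
  assumes K: "max_clique K" and L: "max_clique L" "L \<noteq> K" and st: "s \<in> L" "t \<in> L"
  shows "gate K s = gate K t"
  using edge_gates_differ[OF K max_clique_E[OF L(1) st]] max_clique_eqI[OF K L(1)] L(2) st by metis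

text \<open>Seen from an earlier vertex of the geodesic, the ends of the edge lie at consecutive
  distances, as \<open>gate_eqI\<close> requires. The next lemma is the mirror image.\<close>

lemma geodesic_gate_before:
  assumes K: "max_clique K" and p: "geodesic u v p" "u \<in> V" "v \<in> V"
    and i: "Suc i < length p" "p ! i \<in> K" "p ! Suc i \<in> K" and j: "j \<le> i"
  shows "gate K (p ! j) = p ! i"
proof (rule gate_eqI[OF K _ i(2,3)])
  show "p ! j \<in> V" using geodesic_nth_V p i j by simp
  show "d (p ! j) (p ! Suc i) = Suc (d (p ! j) (p ! i))"
    using geodesic_d_nth[OF p, of j] i j by auto
qed

lemma geodesic_gate_after:
  assumes K: "max_clique K" and p: "geodesic u v p" "u \<in> V" "v \<in> V"
    and i: "p ! i \<in> K" "p ! Suc i \<in> K" and j: "i < j" "j < length p"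
  shows "gate K (p ! j) = p ! Suc i"
proof (rule gate_eqI[OF K _ i(2,1)])
  have V: "p ! j \<in> V" "p ! i \<in> V" "p ! Suc i \<in> V" using geodesic_nth_V p j by auto
  show "p ! j \<in> V" by fact
  show "d (p ! j) (p ! i) = Suc (d (p ! j) (p ! Suc i))"
    using geodesic_d_nth[OF p, of i j] geodesic_d_nth[OF p, of "Suc i" j] j
      d_sym[OF V(1,2)] d_sym[OF V(1,3)] by simp
qed

text \<open>The gate must change somewhere along \<open>p\<close>; by
  \<open>edge_gates_differ\<close> this happens on an edge of \<open>K\<close>, whose ends are then
  the gates of \<open>u\<close> and \<open>v\<close>.\<close>

lemma geodesic_crosses:
  assumes K: "max_clique K" and p: "geodesic u v p" and V: "u \<in> V" "v \<in> V"
    and ne: "gate K u \<noteq> gate K v"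
  obtains i where "Suc i < length p" "p ! i = gate K u" "p ! Suc i = gate K v"
proof -
  have len: "length p = Suc (d u v)" and "p \<noteq> []" and s: "successively E p"
    using p by (auto simp: geodesic_def)
  then have ends: "p ! 0 = u" "p ! d u v = v"
    using p by (auto simp: geodesic_def hd_conv_nth last_conv_nth)
  have "\<exists>i < d u v. gate K (p ! i) \<noteq> gate K (p ! Suc i)"
  proof (rule ccontr)
    assume "\<not> ?thesis"
    then have "gate K (p ! i) = gate K u" if "i \<le> d u v" for i
      using that by (induction i) (auto simp: ends)
    then show False using ne ends by (metis order_refl)
  qed
  then obtain i where i: "i < d u v" "gate K (p ! i) \<noteq> gate K (p ! Suc i)" by blast
  have "E (p ! i) (p ! Suc i)" using s i len by (auto simp: successively_conv_nth)
  then have "p ! i \<in> K" "p ! Suc i \<in> K" using edge_gates_differ[OF K] i by auto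
  then have "gate K (p ! 0) = p ! i" "gate K (p ! d u v) = p ! Suc i"
    using geodesic_gate_before[OF K p V, of i 0] geodesic_gate_after[OF K p V, of i "d u v"] i len
    by auto
  then show ?thesis using that[of i] i len ends by simp
qed

lemma d_through_gates:
  assumes K: "max_clique K" and V: "u \<in> V" "v \<in> V" and ne: "gate K u \<noteq> gate K v"
  shows "d u v = Suc (d u (gate K u) + d (gate K v) v)"
proof -
  obtain p where p: "geodesic u v p" using geodesic_ex V by blast
  have len: "length p = Suc (d u v)" and "p \<noteq> []"
    using p by (auto simp: geodesic_def)
  then have ends: "p ! 0 = u" "p ! d u v = v"
    using p by (auto simp: geodesic_def hd_conv_nth last_conv_nth)
  obtain i where i: "Suc i < length p" "p ! i = gate K u" "p ! Suc i = gate K v"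
    using geodesic_crosses[OF K p V ne] .
  show ?thesis
    using geodesic_d_nth[OF p V, of 0 i] geodesic_d_nth[OF p V, of "Suc i" "d u v"] i ends len by auto
qed

subsection \<open>Cut vertices\<close>

definition cut :: "'a \<Rightarrow> bool" where
  "cut v \<longleftrightarrow> v \<in> V \<and> V \<noteq> {v} \<and> \<not> connected_on E (V - {v})"

text \<open>If \<open>x\<close> is the gate of \<open>w\<close>, a walk from \<open>w\<close> can
  change its gate only by passing through \<open>x\<close>. If \<open>x\<close> is the gate of no
  other vertex, everything else still reaches \<open>K - {x}\<close> once \<open>x\<close> is
  deleted.\<close>

lemma cut_iff_gate:
  assumes K: "max_clique K" and x: "x \<in> K"
  shows "cut x \<longleftrightarrow> (\<exists>w\<in>V. w \<noteq> x \<and> gate K w = x)"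
proof
  obtain y where y: "y \<in> K" "y \<noteq> x" using max_clique_other[OF K] .
  have V: "x \<in> V" "y \<in> V" using x y max_clique_V[OF K] by auto
  {
    assume "\<exists>w\<in>V. w \<noteq> x \<and> gate K w = x"
    then obtain w where w: "w \<in> V" "w \<noteq> x" "gate K w = x" by blast
    have "gate K t = x" if "induced_reach E (V - {x}) w t" for t
      using that unfolding induced_reach_def
    proof (induction rule: rtranclp_induct)
      case (step t t')
      show ?case
      proof (rule ccontr)
        assume "gate K t' \<noteq> x"
        then have "t \<in> K" using edge_gates_differ[OF K, of t t'] step by simp
        then show False using gate_self[OF K] step by simp
      qed
    qed (rule w)
    then have "\<not> induced_reach E (V - {x}) w y"
      using gate_self[OF K y(1)] y by auto
    then show "cut x" using V w y unfolding cut_def connected_on_def by blast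
  }
  assume "cut x"
  show "\<exists>w\<in>V. w \<noteq> x \<and> gate K w = x"
  proof (rule ccontr)
    assume "\<not> ?thesis"
    then have no: "gate K w \<noteq> x" if "w \<in> V" "w \<noteq> x" for w using that by blast
    have "connected_on E (V - {x})"
    proof (rule connected_onI[where A = "K - {x}"])
      fix s assume s: "s \<in> V - {x}"
      then have "E\<^sup>*\<^sup>* s y" using rtranclp_E V by simp
      then show "\<exists>a\<in>K - {x}. induced_reach E (V - {x}) s a"
        using s
      proof (induction rule: converse_rtranclp_induct)
        case base
        then show ?case using y by (intro bexI[of _ y]) auto
      next
        case (step s t)
        show ?case
        proof (cases "t = x")
          case True
          \<comment> \<open>The gates of \<open>s\<close> and \<open>x\<close> differ, so the edge
            between them belongs to \<open>K\<close>.\<close>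
          then have "s \<in> K"
            using edge_gates_differ[OF K step(1)] no[of s] gate_self[OF K x] step.prems by simp
          then show ?thesis using step.prems by (intro bexI[of _ s]) auto
        next
          case False
          then have "t \<in> V - {x}" using E_V step(1) by simp
          then have "induced_reach E (V - {x}) s t"
            using step.prems step(1) by (intro induced_reach_edge)
          then show ?thesis
            using step.IH[OF \<open>t \<in> V - {x}\<close>] induced_reach_trans[of E "V - {x}" s t] by blast
        qed
      qed
    qed (use E_symp K y in \<open>auto dest: max_clique_E max_clique_V\<close>)
    then show False using \<open>cut x\<close> by (simp add: cut_def)
  qed
qed

definition low :: "'a set set" where
  "low = {K. max_clique K \<and> card {v \<in> K. cut v} < 3}"

lemma finite_low: "finite low"
  by (rule finite_subset[of _ "Pow V"]) (use fin in \<open>auto simp: low_def max_clique_def\<close>)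

text \<open>Provides the edge that represents a low block in the lower bound; with fewer than two
  cut vertices the missing ends are chosen freely.\<close>

lemma max_clique_covering_pair:
  assumes "card C < 3" "C \<subseteq> K" "max_clique K"
  obtains a b where "a \<in> K" "b \<in> K" "a \<noteq> b" "C \<subseteq> {a, b}"
proof -
  have "finite K" using assms(3) fin by (auto simp: max_clique_def intro: finite_subset)
  then have "finite C" using assms(2) finite_subset by blast
  consider "C = {}" | a where "C = {a}" | a b where "C = {a, b}" "a \<noteq> b"
  proof -
    have "card C = 0 \<or> card C = 1 \<or> card C = 2" using assms(1) by linarith
    then show ?thesis
      using that \<open>finite C\<close> by (metis One_nat_def card_1_singletonE card_2_iff card_0_eq)
  qed
  then show ?thesis
  proof cases
    case 1
    then show ?thesis using that max_clique_other[OF assms(3)] by (metis empty_subsetI)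
  next
    case (2 a)
    then show ?thesis using that max_clique_other[OF assms(3), of a] assms(2)
      by (metis insert_subset subset_insertI)
  next
    case (3 a b)
    then show ?thesis using that assms(2) by blast
  qed
qed

text \<open>A block containing a vertex farthest from \<open>z\<close> among those behind \<open>z\<close> is a leaf block.\<close>

lemma low_block_behind:
  assumes K: "max_clique K" and z: "z \<in> K" "cut z"
  shows "\<exists>L\<in>low. \<forall>w\<in>L. gate K w = z"
proof -
  have zV: "z \<in> V" using max_clique_V[OF K] z by simp
  let ?F = "{w \<in> V. w \<noteq> z \<and> gate K w = z}"
  have F: "finite (d z ` ?F)" "d z ` ?F \<noteq> {}" using fin cut_iff_gate[OF K z(1)] z(2) by auto
  obtain w where "w \<in> ?F" and max: "Max (d z ` ?F) = d z w"
    using Max_in[OF F] by (elim imageE) simp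
  then have w: "w \<in> V" "w \<noteq> z" "gate K w = z" by simp_all
  have far: "d z s \<le> d z w" if "s \<in> V" "s \<noteq> z" "gate K s = z" for s
    unfolding max[symmetric] using F(1) that by (intro Max_ge) auto
  obtain q where "E w q" using d_step[OF w(1) zV w(2)] by metis
  then obtain L where L: "max_clique L" "w \<in> L" using edge_max_clique by metis
  have "w \<notin> K" using gate_self[OF K] w by metis
  then have "L \<noteq> K" using L by auto
  then have gL: "gate K t = z" if "t \<in> L" for t
    using gate_const[OF K L(1) _ that L(2)] w by simp
  let ?g = "gate L z"
  have gin: "?g \<in> L" using gate_in[OF L(1) zV] .
  \<comment> \<open>Another cut vertex \<open>t\<close> of \<open>L\<close> would be the gate of
    some \<open>s\<close>, and this \<open>s\<close> would be behind \<open>z\<close> but farther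
    away than \<open>w\<close>.\<close>
  have "{t \<in> L. cut t} \<subseteq> {?g}"
  proof (rule ccontr)
    assume "\<not> ?thesis"
    then obtain t where t: "t \<in> L" "cut t" "t \<noteq> ?g" by auto
    then obtain s where s: "s \<in> V" "s \<noteq> t" "gate L s = t"
      using cut_iff_gate[OF L(1)] by auto
    have tV: "t \<in> V" using max_clique_V[OF L(1) t(1)] .
    have "d z s = Suc (d z ?g + d t s)"
      using d_through_gates[OF L(1) zV s(1)] t s by auto
    moreover have "d t s > 0" using d_eq_0[OF tV s(1)] s(2) by blast
    moreover have "d z w \<le> Suc (d z ?g)"
      using d_gate[OF L(1) zV L(2)] by (cases "w = ?g") auto
    ultimately have more: "d z s > d z w" by simp
    have "gate K s = z"
    \<comment> \<open>Otherwise \<open>s\<close> reaches \<open>t\<close> only through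
      \<open>z\<close>, so \<open>t\<close> is at least as far from \<open>s\<close> as
      \<open>z\<close> is, whereas the formula for \<open>d z s\<close> makes \<open>t\<close>
      strictly closer.\<close>
    proof (rule ccontr)
      assume "gate K s \<noteq> z"
      then have "d s t = Suc (d s (gate K s) + d z t)"
        using d_through_gates[OF K s(1) tV] gL[OF t(1)] by auto
      moreover have "d s z = Suc (d s (gate K s))"
        using d_gate[OF K s(1) z(1)] \<open>gate K s \<noteq> z\<close> by auto
      ultimately show False
        using \<open>d z s = Suc (d z ?g + d t s)\<close> d_sym s tV zV by simp
    qed
    then show False using far[OF s(1)] more by (cases "s = z") auto
  qed
  then have "card {t \<in> L. cut t} \<le> 1" using card_mono[of "{?g}"] by simp
  then show ?thesis using L gL unfolding low_def by force
qed

subsection \<open>The colouring\<close>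

text \<open>A relation that leaves some freedom: an edge of a low block may also receive another low
  block whose gates miss the edge. Any choice of colours within it works.\<close>

definition colour_for :: "'a set \<Rightarrow> 'a set \<Rightarrow> bool" where
  "colour_for e L \<longleftrightarrow>
     L \<in> low \<and> (\<exists>K. max_clique K \<and> e \<subseteq> K \<and> (L = K \<or> (\<forall>w\<in>L. gate K w \<notin> e)))"

text \<open>A clique that is not low has a cut vertex off the edge, and
  \<open>low_block_behind\<close> finds a low block there.\<close>

lemma colour_for_ex:
  assumes "E x y"
  shows "\<exists>L. colour_for {x, y} L"
proof -
  obtain K where K: "max_clique K" "x \<in> K" "y \<in> K" using edge_max_clique[OF assms] .
  show ?thesis
  proof (cases "K \<in> low")
    case True
    then show ?thesis using K unfolding colour_for_def by blast
  next
    case False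
    have "\<not> {v \<in> K. cut v} \<subseteq> {x, y}"
    proof
      assume "{v \<in> K. cut v} \<subseteq> {x, y}"
      then have "card {v \<in> K. cut v} \<le> card {x, y}" by (intro card_mono) auto
      also have "\<dots> \<le> 2" by (simp add: card_insert_if)
      finally show False using False K unfolding low_def by simp
    qed
    then obtain z where z: "z \<in> K" "cut z" "z \<noteq> x" "z \<noteq> y" by auto
    then obtain L where "L \<in> low" "\<forall>w\<in>L. gate K w = z"
      using low_block_behind[OF K(1)] by blast
    then have "colour_for {x, y} L"
      unfolding colour_for_def using K z by (intro conjI exI[of _ K]) auto
    then show ?thesis ..
  qed
qed

text \<open>A common colour is, for each of the two edges, its own clique or a block whose gates
  miss the edge. Each of the four combinations contradicts the gates along the geodesic.\<close>

lemma colour_for_geodesic: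
  assumes p: "geodesic u v p" and V: "u \<in> V" "v \<in> V" and ij: "i < j" "Suc j < length p"
    and L: "colour_for {p ! i, p ! Suc i} L" and L': "colour_for {p ! j, p ! Suc j} L'"
  shows "L \<noteq> L'"
proof
  assume eq: "L = L'"
  let ?x = "p ! i" and ?y = "p ! Suc i" and ?x' = "p ! j" and ?y' = "p ! Suc j"
  obtain K where K: "max_clique K" "?x \<in> K" "?y \<in> K"
    and c: "L = K \<or> (\<forall>w\<in>L. gate K w \<noteq> ?x \<and> gate K w \<noteq> ?y)"
    using L unfolding colour_for_def by auto
  obtain K' where K': "max_clique K'" "?x' \<in> K'" "?y' \<in> K'"
    and c': "L = K' \<or> (\<forall>w\<in>L. gate K' w \<noteq> ?x' \<and> gate K' w \<noteq> ?y')"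
    using L' eq unfolding colour_for_def by auto
  have inV: "?x \<in> V" "?y \<in> V" "?x' \<in> V" "?y' \<in> V" using geodesic_nth_V[OF p V(1)] ij by auto
  have gx: "gate K' ?x = ?x'" using geodesic_gate_before[OF K'(1) p V] K' ij by auto
  have gy': "gate K ?y' = ?y" using geodesic_gate_after[OF K(1) p V] K ij by auto
  consider "L = K" "L = K'" | "L = K" "L \<noteq> K'" | "L \<noteq> K" "L = K'" | "L \<noteq> K" "L \<noteq> K'" by blast
  then show False
  proof cases
    case 1
    then have "gate K ?y' = ?y'" using gate_self K' by metis
    then have "?y = ?y'" using gy' by simp
    then show False using geodesic_d_nth[OF p V, of "Suc i" "Suc j"] ij by simp
  next
    case 2
    then show False using c' gx K by blast
  next
    case 3
    then show False using c gy' K' by blast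
  next
    case 4
    \<comment> \<open>For \<open>w\<close> in \<open>L\<close>, a geodesic to \<open>?x\<close>
      enters through \<open>?x'\<close>, and from there \<open>?y\<close> is one step closer than
      \<open>?x\<close>. So \<open>w\<close> is closer to \<open>?y\<close> than to
      \<open>?x\<close>, although neither is its gate in \<open>K\<close>.\<close>
    have "max_clique L" using L by (auto simp: colour_for_def low_def)
    then obtain w where w: "w \<in> L" "w \<in> V" using max_clique_other max_clique_V by metis
    have a: "gate K w \<noteq> ?x" "gate K w \<noteq> ?y" "gate K' w \<noteq> ?x'" using c c' 4 w by auto
    have "d w ?x = Suc (d w (gate K' w) + d ?x' ?x)"
      using d_through_gates[OF K'(1) w(2) inV(1)] gx a by simp
    moreover have "d w ?x' = Suc (d w (gate K' w))" using d_gate[OF K'(1) w(2) K'(2)] a by simp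
    moreover have "d ?x' ?x = Suc (d ?x' ?y)"
      using geodesic_d_nth[OF p V, of i j] geodesic_d_nth[OF p V, of "Suc i" j] ij d_sym inV by auto
    moreover have "d w ?y \<le> d w ?x' + d ?x' ?y" using d_triangle w inV by blast
    moreover have "d w ?x = d w ?y" using d_gate[OF K(1) w(2)] K a by metis
    ultimately show False by simp
  qed
qed

section \<open>Upper and lower bound on the number of colours\<close>

definition strong_rainbow :: "('a set \<Rightarrow> 'c) \<Rightarrow> bool" where
  "strong_rainbow c \<longleftrightarrow> (\<forall>u\<in>V. \<forall>v\<in>V. \<exists>p. geodesic u v p \<and>
     (\<forall>i j. i < j \<longrightarrow> Suc j < length p \<longrightarrow> c {p ! i, p ! Suc i} \<noteq> c {p ! j, p ! Suc j}))"

lemma strong_rainbow_ex: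
  obtains c :: "'a set \<Rightarrow> nat" where "strong_rainbow c" "\<And>x y. E x y \<Longrightarrow> c {x, y} < card low"
proof -
  define col where "col e = (SOME L. colour_for e L)" for e
  have col: "colour_for {x, y} (col {x, y})" if "E x y" for x y
    using colour_for_ex[OF that] unfolding col_def by (rule someI_ex)
  \<comment> \<open>Numbering the low blocks turns them into the natural numbers that
    \<open>src\<close> uses as colours.\<close>
  obtain f where f: "bij_betw f low {0..<card low}"
    using ex_bij_betw_finite_nat[OF finite_low] by blast
  have low: "col {x, y} \<in> low" if "E x y" for x y using col[OF that] by (simp add: colour_for_def)
  show ?thesis
  proof (rule that[of "f \<circ> col"])
    show "(f \<circ> col) {x, y} < card low" if "E x y" for x y
      using low[OF that] bij_betwE[OF f] by auto
    show "strong_rainbow (f \<circ> col)"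
      unfolding strong_rainbow_def
    proof (intro ballI)
      fix u v assume V: "u \<in> V" "v \<in> V"
      obtain p where p: "geodesic u v p" using geodesic_ex V by blast
      have "(f \<circ> col) {p ! i, p ! Suc i} \<noteq> (f \<circ> col) {p ! j, p ! Suc j}"
        if ij: "i < j" "Suc j < length p" for i j
      proof -
        have "E (p ! i) (p ! Suc i)" "E (p ! j) (p ! Suc j)"
          using p ij by (auto simp: geodesic_def successively_conv_nth)
        then show ?thesis
          using colour_for_geodesic[OF p V ij] col low f unfolding bij_betw_def
          by (metis comp_apply inj_on_contraD)
      qed
      then show "\<exists>p. geodesic u v p \<and> (\<forall>i j. i < j \<longrightarrow> Suc j < length p \<longrightarrow>
          (f \<circ> col) {p ! i, p ! Suc i} \<noteq> (f \<circ> col) {p ! j, p ! Suc j})"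
        using p by blast
    qed
  qed
qed

text \<open>Each low block is represented by an edge \<open>e B\<close> covering its cut vertices.
  Two such edges lie on a common geodesic, and any geodesic between its end vertices contains both,
  so \<open>c\<close> separates them.\<close>

lemma card_low_le:
  assumes "strong_rainbow c"
  shows "card low \<le> card (c ` {{x, y} | x y. E x y})"
proof -
  let ?C = "c ` {{x, y} | x y. E x y}"
  define good where "good B e \<longleftrightarrow>
    (\<exists>a b. e = {a, b} \<and> a \<in> B \<and> b \<in> B \<and> a \<noteq> b \<and> {v \<in> B. cut v} \<subseteq> {a, b})" for B e
  have "\<exists>e. good B e" if "B \<in> low" for B
  proof -
    have "max_clique B" "card {v \<in> B. cut v} < 3" using that by (simp_all add: low_def)
    then obtain a b where "a \<in> B" "b \<in> B" "a \<noteq> b" "{v \<in> B. cut v} \<subseteq> {a, b}"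
      using max_clique_covering_pair[of "{v \<in> B. cut v}" B] by blast
    then show ?thesis unfolding good_def by blast
  qed
  then have "\<forall>B\<in>low. \<exists>e. good B e" by blast
  from bchoice[OF this] obtain e where "\<forall>B\<in>low. good B (e B)" ..
  then have e: "\<exists>a b. e B = {a, b} \<and> a \<in> B \<and> b \<in> B \<and> a \<noteq> b \<and> {v \<in> B. cut v} \<subseteq> {a, b}"
    if "B \<in> low" for B
    using that unfolding good_def by blast
  \<comment> \<open>From \<open>B\<close>, the block \<open>B'\<close> is seen through one gate. It
    is the gate of a vertex outside \<open>B\<close>, hence a cut vertex and an end of
    \<open>e B\<close>; \<open>t\<close> is the other end.\<close>
  have split: "\<exists>t. e B = {t, gate B s} \<and> t \<in> B \<and> gate B s \<in> B \<and> t \<noteq> gate B s"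
    if B: "B \<in> low" and B': "B' \<in> low" "B \<noteq> B'" "s \<in> B'" for B B' s
  proof -
    have mc: "max_clique B" "max_clique B'" using B B' by (auto simp: low_def)
    have "\<not> B' \<subseteq> B"
    proof
      assume "B' \<subseteq> B"
      then have "B = B'" using mc by (simp add: max_clique_def)
      then show False using B'(2) by simp
    qed
    then obtain w where w: "w \<in> B'" "w \<notin> B" by blast
    have wV: "w \<in> V" using w mc max_clique_V by blast
    have g: "gate B s = gate B w" using gate_const[OF mc _ B'(3) w(1)] B'(2) by simp
    have "gate B w \<in> B" using gate_in[OF mc(1) wV] .
    then have "cut (gate B w)" using cut_iff_gate[OF mc(1)] w wV by metis
    then have "gate B s \<in> e B" "gate B s \<in> B" using e[OF B] \<open>gate B w \<in> B\<close> g by auto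
    then show ?thesis using e[OF B] by (auto simp: insert_commute)
  qed
  have "inj_on (\<lambda>B. c (e B)) low"
  proof (rule inj_onI, rule ccontr)
    fix B B' assume B: "B \<in> low" "B' \<in> low" and ceq: "c (e B) = c (e B')" and ne: "B \<noteq> B'"
    have mc: "max_clique B" "max_clique B'" using B by (auto simp: low_def)
    obtain s s' where ss: "s \<in> B'" "s' \<in> B" using mc max_clique_other by metis
    obtain t where t: "e B = {t, gate B s}" "t \<in> B" "gate B s \<in> B" "t \<noteq> gate B s"
      using split[OF B ne ss(1)] by blast
    obtain t' where t': "e B' = {t', gate B' s'}" "t' \<in> B'" "gate B' s' \<in> B'" "t' \<noteq> gate B' s'"
      using split[OF B(2,1) ne[symmetric] ss(2)] by blast
    have V: "t \<in> V" "t' \<in> V" using t t' mc max_clique_V by blast+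
    \<comment> \<open>The outer ends of the two edges have different gates in \<open>B\<close> and
      in \<open>B'\<close>, so the geodesic crosses both edges.\<close>
    obtain p where p: "geodesic t t' p"
      and rb: "\<And>i j. i < j \<Longrightarrow> Suc j < length p \<Longrightarrow> c {p ! i, p ! Suc i} \<noteq> c {p ! j, p ! Suc j}"
      using assms V unfolding strong_rainbow_def by blast
    have g: "gate B t = t" "gate B t' = gate B s" "gate B' t = gate B' s'" "gate B' t' = t'"
      using gate_self mc t t' gate_const[OF mc] gate_const[OF mc(2,1)] ne ss by metis+
    obtain i where i: "Suc i < length p" "p ! i = t" "p ! Suc i = gate B s"
      using geodesic_crosses[OF mc(1) p V] g t by metis
    obtain j where j: "Suc j < length p" "p ! j = gate B' s'" "p ! Suc j = t'"
      using geodesic_crosses[OF mc(2) p V] g t' by metis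
    have "i \<noteq> j" using max_clique_eqI[OF mc] i j t t' ne by metis
    moreover have "c {p ! i, p ! Suc i} = c {p ! j, p ! Suc j}"
      using ceq i j t t' by (simp add: insert_commute)
    ultimately show False using rb i j by (metis nat_neq_iff)
  qed
  moreover have "(\<lambda>B. c (e B)) ` low \<subseteq> ?C"
  proof safe
    fix B assume B: "B \<in> low"
    then obtain a b where "e B = {a, b}" "a \<in> B" "b \<in> B" "a \<noteq> b" using e by blast
    moreover have "max_clique B" using B by (simp add: low_def)
    ultimately show "c (e B) \<in> ?C" using max_clique_E by blast
  qed
  moreover have "finite ?C"
    by (rule finite_imageI, rule finite_subset[of _ "Pow V"]) (use fin E_V in auto)
  ultimately show ?thesis by (rule card_inj_on_le)
qed

end

subsection \<open>Blocks as maximal cliques\<close>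

lemma induced_reach_cong:
  assumes "\<And>u v. u \<in> S \<Longrightarrow> v \<in> S \<Longrightarrow> E u v \<longleftrightarrow> E' u v"
  shows "induced_reach E S = induced_reach E' S"
proof -
  have "(\<lambda>u v. E u v \<and> u \<in> S \<and> v \<in> S) = (\<lambda>u v. E' u v \<and> u \<in> S \<and> v \<in> S)"
    using assms by blast
  then show ?thesis by (simp add: induced_reach_def)
qed

lemma clique_on_biconnected_on:
  assumes "symp E" "clique_on E S" "S \<noteq> {}"
  shows "biconnected_on E S"
proof -
  have conn: "connected_on E T" if "T \<subseteq> S" "T \<noteq> {}" for T
  proof (rule connected_onI[where A = T])
    show "\<exists>a\<in>T. induced_reach E T s a" if "s \<in> T" for s
      using that by (intro bexI[of _ s]) simp_all
    show "E a b" if "a \<in> T" "b \<in> T" "a \<noteq> b" for a b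
      using assms(2) that \<open>T \<subseteq> S\<close> unfolding clique_on_def by blast
  qed (use assms that in simp_all)
  show ?thesis
    unfolding biconnected_on_def
  proof (intro conjI ballI impI)
    show "connected_on E S" using assms(3) by (simp add: conn)
    show "connected_on E (S - {v})" if "v \<in> S" "S \<noteq> {v}" for v
      by (rule conn) (use that in auto)
  qed
qed

section \<open>Transfer from induced subgraphs to vertex sets\<close>

lemma dominates_induce:
  "u \<rightarrow>\<^bsub>G \<restriction> S\<^esub> v \<longleftrightarrow> u \<rightarrow>\<^bsub>G\<^esub> v \<and> u \<in> S \<and> v \<in> S"
  by (auto simp: arcs_ends_conv)

lemma (in graph) symp_dominates: "symp (dominates G)"
  by (auto intro: sympI graph_symmetric)

lemma (in graph) graph_induce:
  assumes "S \<subseteq> verts G"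
  shows "graph (G \<restriction> S)"
proof -
  have sub: "subgraph (G \<restriction> S) G" using assms by (rule subgraph_induce_subgraphI)
  have "induced_subgraph (G \<restriction> S) G" using assms by (rule induced_induce)
  then have "symmetric (G \<restriction> S)" using induced_graph_imp_symmetric sym_arcs by blast
  then show ?thesis using digraph.graphI[OF digraph_subgraph[OF sub]] by blast
qed

text \<open>\<open>connected\<close> asks for strong connectivity of the symmetric closure, which
  has the same reachability as a graph that is already symmetric.\<close>

lemma (in graph) connected_iff_connected_on:
  "connected G \<longleftrightarrow> connected_on (dominates G) (verts G)"
proof -
  have "u \<rightarrow>\<^sup>*\<^bsub>mk_symmetric G\<^esub> v \<longleftrightarrow> induced_reach (dominates G) (verts G) u v"
    if "u \<in> verts G" for u v
  proof -
    have "(\<lambda>u v. u \<rightarrow> v \<and> u \<in> verts G \<and> v \<in> verts G) = dominates G"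
      using adj_in_verts by blast
    then have "induced_reach (dominates G) (verts G) u v \<longleftrightarrow> (u, v) \<in> (arcs_ends G)\<^sup>*"
      by (simp add: induced_reach_def rtranclp_rtrancl_eq)
    then show ?thesis
      using reachable_mk_symmetric_eq[OF sym_arcs] reachable_conv'[OF that] by simp
  qed
  then show ?thesis by (simp add: connected_def strongly_connected_def connected_on_def)
qed

context graph begin

lemma connected_induce:
  assumes "S \<subseteq> verts G"
  shows "connected (G \<restriction> S) \<longleftrightarrow> connected_on (dominates G) S"
proof -
  interpret H: graph "G \<restriction> S" using assms by (rule graph_induce)
  have "induced_reach (dominates (G \<restriction> S)) S = induced_reach (dominates G) S"
    by (rule induced_reach_cong) (simp add: dominates_induce)
  then show ?thesis using H.connected_iff_connected_on by (simp add: connected_on_def)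
qed

lemma del_vert_eq_induce: "del_vert v = G \<restriction> (verts G - {v})"
  by (auto simp: del_vert_def induce_subgraph_def)

lemma cut_vertex_iff:
  "cut_vertex G v \<longleftrightarrow>
     v \<in> verts G \<and> verts G \<noteq> {v} \<and> \<not> connected_on (dominates G) (verts G - {v})"
  unfolding cut_vertex_def del_vert_eq_induce by (simp add: connected_induce)

lemma biconnected_induce:
  assumes S: "S \<subseteq> verts G"
  shows "biconnected (G \<restriction> S) \<longleftrightarrow> biconnected_on (dominates G) S"
proof -
  interpret H: graph "G \<restriction> S" using S by (rule graph_induce)
  have "connected_on (dominates (G \<restriction> S)) T \<longleftrightarrow> connected_on (dominates G) T" if "T \<subseteq> S" for T
  proof -
    have "induced_reach (dominates (G \<restriction> S)) T = induced_reach (dominates G) T"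
      by (rule induced_reach_cong) (use that in \<open>auto simp: dominates_induce\<close>)
    then show ?thesis by (simp add: connected_on_def)
  qed
  then show ?thesis
    unfolding biconnected_def biconnected_on_def H.cut_vertex_iff connected_induce[OF S] by auto
qed

text \<open>By finiteness some biconnected subgraph above \<open>H\<close> has the largest total
  number of vertices and arcs, and no proper extension of it can be biconnected.\<close>

lemma biconnected_subgraph_in_block:
  assumes "subgraph H G" "graph H" "edges H \<noteq> {}" "biconnected H"
  obtains B where "block G B" "subgraph H B"
proof -
  let ?P = "\<lambda>H. subgraph H G \<and> graph H \<and> edges H \<noteq> {} \<and> biconnected H"
  let ?m = "\<lambda>H :: ('a, 'b) pre_digraph. card (verts H) + card (arcs H)"
  have "wf_digraph H" using assms(1) by auto
  then have H: "?P H \<and> subgraph H H" using assms wf_digraph.subgraph_refl by blast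
  have "\<forall>H'. ?P H' \<and> subgraph H H' \<longrightarrow> ?m H' < Suc (?m G)"
  proof (intro allI impI)
    fix H' assume "?P H' \<and> subgraph H H'"
    then have "verts H' \<subseteq> verts G" "arcs H' \<subseteq> arcs G" by auto
    then show "?m H' < Suc (?m G)"
      using card_mono[OF finite_verts] card_mono[OF finite_arcs] by (metis add_mono less_Suc_eq_le)
  qed
  then obtain B where B: "?P B" "subgraph H B"
    and max: "\<And>H'. ?P H' \<Longrightarrow> subgraph H H' \<Longrightarrow> ?m H' \<le> ?m B"
    using ex_has_greatest_nat[of "\<lambda>H'. ?P H' \<and> subgraph H H'" H ?m "Suc (?m G)"] H by blast
  have "block G B"
    unfolding block_def
  proof (rule max_subgraphI)
    fix H' assume H': "B \<noteq> H'" "subgraph B H'" "subgraph H' G"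
    show "\<not> (graph H' \<and> edges H' \<noteq> {} \<and> biconnected H')"
    proof
      assume "graph H' \<and> edges H' \<noteq> {} \<and> biconnected H'"
      then have P': "?P H'" using H' by blast
      then interpret H': graph H' by blast
      have le: "?m H' \<le> ?m B" using max[OF P'] subgraph_trans[OF B(2) H'(2)] by blast
      have sub: "verts B \<subseteq> verts H'" "arcs B \<subseteq> arcs H'" "compatible H' B" using H'(2) by auto
      have "card (verts B) \<le> card (verts H')" "card (arcs B) \<le> card (arcs H')"
        using sub by (auto intro: card_mono)
      then have "card (verts B) = card (verts H')" "card (arcs B) = card (arcs H')"
        using le by linarith+
      then have "verts B = verts H'" "arcs B = arcs H'"
        using card_subset_eq sub H'.finite_verts H'.finite_arcs by blast+
      \<comment> \<open>Compatibility supplies equal head and tail maps.\<close>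
      then have "B = H'" using sub(3) by (simp add: compatible_def)
      then show False using H'(1) by simp
    qed
  qed (use B in auto)
  then show ?thesis using that B by blast
qed

lemma edges_induce:
  assumes "2 \<le> card S" "connected_on (dominates G) S"
  shows "edges (G \<restriction> S) \<noteq> {}"
proof -
  obtain u v where uv: "u \<in> S" "v \<in> S" "u \<noteq> v"
    using assms(1) by (metis One_nat_def Suc_1 card_le_Suc0_iff_eq card.infinite not_less_eq_eq le0)
  then have "(\<lambda>u v. u \<rightarrow> v \<and> u \<in> S \<and> v \<in> S)\<^sup>*\<^sup>* u v"
    using assms(2) by (simp add: connected_on_def induced_reach_def)
  then obtain w where "u \<rightarrow> w" "w \<in> S"
    using uv by (cases rule: converse_rtranclpE) auto
  then have "u \<rightarrow>\<^bsub>G \<restriction> S\<^esub> w" using uv by (simp add: dominates_induce)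
  then show ?thesis unfolding edges_def by blast
qed

end

locale finite_connected_block_graph = graph G for G :: "('a, 'b) pre_digraph" +
  assumes conn: "connected G" and bg: "block_graph G"
begin

lemma block_clique: "block G B \<Longrightarrow> clique_on (dominates G) (verts B)"
proof -
  assume B: "block G B"
  then have "arcs_ends B = {(u, v). (u, v) \<in> verts B \<times> verts B \<and> u \<noteq> v}"
    using bg by (simp add: block_graph_def complete_digraph_def)
  moreover have "arcs_ends B \<subseteq> arcs_ends G"
    using B arcs_ends_mono subgraphI_max_subgraph by (auto simp: block_def)
  ultimately show ?thesis unfolding clique_on_def by blast
qed

lemma biconnected_on_block:
  assumes "S \<subseteq> verts G" "biconnected_on (dominates G) S" "2 \<le> card S"
  obtains B where "block G B" "subgraph (G \<restriction> S) B"
proof (rule biconnected_subgraph_in_block)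
  show "subgraph (G \<restriction> S) G" "graph (G \<restriction> S)"
    using assms(1) by (rule subgraph_induce_subgraphI, rule graph_induce)
  show "biconnected (G \<restriction> S)" using assms biconnected_induce by simp
  show "edges (G \<restriction> S) \<noteq> {}"
    using assms edges_induce by (simp add: biconnected_on_def)
qed

sublocale connected_block_graph "verts G" "dominates G"
proof
  show "clique_on (dominates G) S"
    if S: "S \<subseteq> verts G" "biconnected_on (dominates G) S" for S
  \<comment> \<open>A set with two or more vertices is enclosed in a block; smaller ones are cliques
    trivially.\<close>
  proof (cases "2 \<le> card S")
    case True
    then obtain B where "block G B" "subgraph (G \<restriction> S) B" using biconnected_on_block S by blast
    then show ?thesis
      using block_clique[of B] subgraph_imp_subverts[of "G \<restriction> S" B] by (auto simp: clique_on_def)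
  next
    case False
    then have "card S \<le> Suc 0" by simp
    then show ?thesis
      using S(1) finite_subset[OF _ finite_verts] by (auto simp: clique_on_def card_le_Suc0_iff_eq)
  qed
  show "connected_on (dominates G) (verts G)" using conn connected_iff_connected_on by blast
qed (use symp_dominates adj_in_verts adj_not_same in auto)

text \<open>A block around \<open>K\<close> has a clique as vertex set, so maximality of
  \<open>K\<close> forces equal vertices; its arcs are squeezed between those of
  \<open>G \<restriction> K\<close>.\<close>

lemma max_clique_is_block:
  assumes "max_clique K"
  shows "block G (G \<restriction> K)"
proof -
  have K: "K \<subseteq> verts G" "2 \<le> card K" "clique_on (dominates G) K"
    using assms by (auto simp: max_clique_def)
  then have bi: "biconnected_on (dominates G) K"
    using clique_on_biconnected_on[OF symp_dominates] by fastforce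
  obtain B where B: "block G B" "subgraph (G \<restriction> K) B"
    using biconnected_on_block[OF K(1) bi K(2)] .
  have sub: "subgraph B G" using B(1) subgraphI_max_subgraph by (auto simp: block_def)
  have "K \<subseteq> verts B" "verts B \<subseteq> verts G" 
    using subgraph_imp_subverts[OF B(2)] subgraph_imp_subverts[OF sub] by simp_all
  then have "verts B = K" using assms block_clique[OF B(1)] unfolding max_clique_def by blast
  moreover have "arcs B = arcs (G \<restriction> K)"
  proof
    show "arcs B \<subseteq> arcs (G \<restriction> K)"
      using subgraph_induce_subgraphI2[OF sub] unfolding \<open>verts B = K\<close> by (rule subgraphE)
    show "arcs (G \<restriction> K) \<subseteq> arcs B" using B(2) by blast
  qed
  ultimately have "B = G \<restriction> K" using B(2) by (auto simp: compatible_def)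
  then show ?thesis using B by simp
qed

text \<open>Extending the vertices of \<open>B\<close> to a maximal clique \<open>K\<close> gives a
  block \<open>G \<restriction> K\<close> above \<open>B\<close>, and blocks are maximal.\<close>

lemma block_max_clique:
  assumes B: "block G B"
  shows "max_clique (verts B)" "B = G \<restriction> verts B"
proof -
  have sub: "subgraph B G" and e: "edges B \<noteq> {}" and gB: "graph B"
    using B by (auto simp: block_def pre_digraph.max_subgraph_def)
  interpret B: graph B by (rule gB)
  have cl: "clique_on (dominates G) (verts B)" using block_clique B .
  obtain x y where xy: "x \<rightarrow>\<^bsub>B\<^esub> y" using e by (auto simp: edges_def)
  then have "{x, y} \<subseteq> verts B" "card {x, y} = 2"
    using B.adj_in_verts B.adj_not_same by (auto simp: card_insert_if)
  then have c: "2 \<le> card (verts B)" using card_mono[OF B.finite_verts] by metis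
  obtain K where K: "max_clique K" "verts B \<subseteq> K"
    using max_clique_ex[OF cl _ c] sub by blast
  have "subgraph B (G \<restriction> K)"
    using sub K(2) B.wf_digraph B.wellformed by (auto simp: subgraph_def compatible_def)
  moreover have "block G (G \<restriction> K)" by (rule max_clique_is_block[OF K(1)])
  ultimately have "B = G \<restriction> K"
    using B max_subgraph_subg_eq unfolding block_def by blast
  then show "max_clique (verts B)" "B = G \<restriction> verts B" using K(1) by simp_all
qed

lemma cut_vertex_iff_cut: "cut_vertex G v \<longleftrightarrow> cut v"
  by (simp add: cut_vertex_iff cut_def)

lemma card_low_eq: "card low = card {B. block G B \<and> card {v \<in> verts B. cut_vertex G v} < 3}"
proof (rule bij_betw_same_card)
  show "bij_betw (\<lambda>K. G \<restriction> K) low {B. block G B \<and> card {v \<in> verts B. cut_vertex G v} < 3}"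
    by (rule bij_betw_byWitness[where f' = verts])
      (use block_max_clique max_clique_is_block in \<open>auto simp: low_def cut_vertex_iff_cut\<close>)
qed

subsection \<open>Rainbow shortest paths\<close>

lemma vwalk_iff: "vwalk p G \<longleftrightarrow> p \<noteq> [] \<and> set p \<subseteq> verts G \<and> successively (dominates G) p"
proof -
  have "set (vwalk_arcs p) \<subseteq> arcs_ends G \<longleftrightarrow> successively (dominates G) p"
    by (induction p rule: vwalk_arcs.induct) auto
  then show ?thesis unfolding vwalk_def by blast
qed

lemma path_between_geodesic:
  assumes p: "geodesic u v p" and V: "u \<in> verts G" "v \<in> verts G"
  shows "path_between G u v p"
proof -
  have "set p \<subseteq> verts G" using geodesic_nth_V[OF p V(1)] by (auto simp: in_set_conv_nth)
  moreover have "distinct p"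
  proof (unfold distinct_conv_nth, intro allI impI)
    fix i j assume "i < length p" "j < length p" "i \<noteq> j"
    then show "p ! i \<noteq> p ! j"
      using geodesic_d_nth[OF p V, of i j] geodesic_d_nth[OF p V, of j i] d_self
      by (cases i j rule: linorder_cases) force+
  qed
  ultimately show ?thesis
    using p unfolding path_between_def vpath_def vwalk_iff geodesic_def by auto
qed

lemma d_le_path:
  assumes "path_between G u v q"
  shows "d u v \<le> vwalk_length q" "q \<noteq> []"
proof -
  have q: "q \<noteq> []" "successively (dominates G) q" "hd q = u" "last q = v"
    using assms by (auto simp: path_between_def vpath_def vwalk_iff)
  then show "d u v \<le> vwalk_length q"
    using successively_relpowp[OF q(2), of 0 "length q - 1"] d_le
    by (simp add: hd_conv_nth last_conv_nth)
  show "q \<noteq> []" by fact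
qed

text \<open>\<open>shortest_path\<close> minimises over paths and \<open>d\<close> over walks; as a
  geodesic is itself a path, the two minima agree.\<close>

lemma shortest_path_iff_geodesic:
  assumes V: "u \<in> verts G" "v \<in> verts G"
  shows "shortest_path G u v p \<longleftrightarrow> geodesic u v p"
proof
  assume p: "geodesic u v p"
  then have "vwalk_length p = d u v" by (simp add: geodesic_def)
  then show "shortest_path G u v p"
    using path_between_geodesic[OF p V] d_le_path unfolding shortest_path_def by simp
next
  assume p: "shortest_path G u v p"
  obtain q where q: "geodesic u v q" using geodesic_ex V by blast
  then have "vwalk_length p \<le> vwalk_length q"
    using p path_between_geodesic[OF q V] unfolding shortest_path_def by blast
  \<comment> \<open>\<open>vwalk_length\<close> is zero for the empty list too, so nonemptiness of
    \<open>p\<close> enters here.\<close>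
  then have "length p = Suc (d u v)"
    using d_le_path[of u v p] p q unfolding shortest_path_def geodesic_def
    by (cases p) auto
  then show "geodesic u v p"
    using p unfolding shortest_path_def path_between_def vpath_def vwalk_iff geodesic_def by blast
qed

end

lemma vwalk_arcs_nth: "Suc i < length p \<Longrightarrow> vwalk_arcs p ! i = (p ! i, p ! Suc i)"
proof (induction p arbitrary: i rule: vwalk_arcs.induct)
  case (3 x y xs)
  then show ?case by (cases i) auto
qed auto

lemma rainbow_iff:
  "rainbow c p \<longleftrightarrow>
     (\<forall>i j. i < j \<longrightarrow> Suc j < length p \<longrightarrow> c {p ! i, p ! Suc i} \<noteq> c {p ! j, p ! Suc j})"
proof -
  let ?f = "\<lambda>(u, v). c {u, v}"
  have len: "length (vwalk_arcs p) = length p - 1"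
    using vwalk_length_simp[of p] unfolding vwalk_length_def .
  have "rainbow c p \<longleftrightarrow> (\<forall>i j. i < j \<longrightarrow> j < length p - 1 \<longrightarrow>
      ?f (vwalk_arcs p ! i) \<noteq> ?f (vwalk_arcs p ! j))"
    
    unfolding rainbow_def distinct_conv_nth length_map len
  proof (intro iffI allI impI)
    fix i j
    assume *: "\<forall>i < length p - 1. \<forall>j < length p - 1.
        i \<noteq> j \<longrightarrow> map ?f (vwalk_arcs p) ! i \<noteq> map ?f (vwalk_arcs p) ! j"
      and "i < j" "j < length p - 1"
    then show "?f (vwalk_arcs p ! i) \<noteq> ?f (vwalk_arcs p ! j)" using len by auto
  next
    fix i j
    assume *: "\<forall>i j. i < j \<longrightarrow> j < length p - 1 \<longrightarrow> ?f (vwalk_arcs p ! i) \<noteq> ?f (vwalk_arcs p ! j)"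
      and "i < length p - 1" "j < length p - 1" "i \<noteq> j"
    then show "map ?f (vwalk_arcs p) ! i \<noteq> map ?f (vwalk_arcs p) ! j"
      using *[rule_format, of i j] *[rule_format, of j i] len
      by (cases i j rule: linorder_cases) (auto dest: sym)
  qed
  also have "\<dots> \<longleftrightarrow>
     (\<forall>i j. i < j \<longrightarrow> Suc j < length p \<longrightarrow> c {p ! i, p ! Suc i} \<noteq> c {p ! j, p ! Suc j})"
    by (auto simp: vwalk_arcs_nth less_diff_conv)
  finally show ?thesis .
qed

lemma (in finite_connected_block_graph) strongly_rainbow_connected_iff:
  "strongly_rainbow_connected G c \<longleftrightarrow> strong_rainbow c"
  unfolding strongly_rainbow_connected_def strong_rainbow_def rainbow_iff
  by (simp add: shortest_path_iff_geodesic)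

theorem theorem8:
  fixes G :: "('a, 'b) pre_digraph"
  assumes "graph G" and "connected G" and "block_graph G"
  shows "src G = card {B. block G B \<and> card {v \<in> verts B. cut_vertex G v} < 3}"
proof -
  interpret finite_connected_block_graph G
    using assms by (simp add: finite_connected_block_graph_def finite_connected_block_graph_axioms_def)
  obtain c :: "'a set \<Rightarrow> nat" where c: "strong_rainbow c" "\<And>x y. x \<rightarrow>\<^bsub>G\<^esub> y \<Longrightarrow> c {x, y} < card low"
    using strong_rainbow_ex by blast
  have "c ` edges G \<subseteq> {..<card low}" using c(2) by (auto simp: edges_def)
  then have "card (c ` edges G) \<le> card low" using card_mono[of "{..<card low}"] by fastforce
  \<comment> \<open>\<open>src\<close> ranges over exact colour counts, so the lower bound also
    serves to show that \<open>c\<close> uses all \<open>card low\<close> colours.\<close>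
  then have eq: "card (c ` edges G) = card low"
    using card_low_le[OF c(1)] by (simp add: edges_def)
  have "src G = card low"
    unfolding src_def
  proof (rule Least_equality)
    show "\<exists>c :: 'a set \<Rightarrow> nat. strongly_rainbow_connected G c \<and> card (c ` edges G) = card low"
      using c(1) eq strongly_rainbow_connected_iff by blast
    show "card low \<le> n"
      if "\<exists>c :: 'a set \<Rightarrow> nat. strongly_rainbow_connected G c \<and> card (c ` edges G) = n" for n
      using that card_low_le strongly_rainbow_connected_iff by (auto simp: edges_def)
  qed
  then show ?thesis using card_low_eq by simp
qed

end
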